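(* Let $G'$ be a group with a normal subgroup $Q_8 \triangleleft G'$ (that is, a normal subgroup isomorphic to, and identified with, the quaternion group of order $8$). Let $a,b$ be commuting elements of $G'$. Then the number of pairs $(\gamma_1,\gamma_2)\in Q_8\times Q_8$ such that $a\gamma_1$ commutes with $b\gamma_2$ is equal to $8$, $16$, $24$, or $40$.
   Context: $Q_8=\{\pm1,\pm i,\pm j,\pm k\}$ is the quaternion group. The group $G'$ is arbitrary (not necessarily finite). *)

theory Defs
  imports "HOL-Algebra.Coset"
begin

text \<open>
  A tuple \<open>(w, x, y, z)\<close> of integers stands for the quaternion \<open>w + x i + y j + z k\<close>.
\<close>

type_synonym int_quat = "int \<times> int \<times> int \<times> int"

fun quat_mult :: "int_quat \<Rightarrow> int_quat \<Rightarrow> int_quat" where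
  "quat_mult (a, b, c, d) (a', b', c', d') =
     (a * a' - b * b' - c * c' - d * d',
      a * b' + b * a' + c * d' - d * c',
      a * c' - b * d' + c * a' + d * b',
      a * d' + b * c' - c * b' + d * a')"

definition Q8 :: "int_quat monoid" where
  "Q8 = \<lparr>carrier = {( 1, 0, 0, 0), (-1, 0, 0, 0),
                    ( 0, 1, 0, 0), ( 0,-1, 0, 0),
                    ( 0, 0, 1, 0), ( 0, 0,-1, 0),
                    ( 0, 0, 0, 1), ( 0, 0, 0,-1)},
         mult = quat_mult, one = (1, 0, 0, 0)\<rparr>"

lemma quat_mult_assoc: "quat_mult (quat_mult p q) r = quat_mult p (quat_mult q r)"
  by (cases p; cases q; cases r) (simp add: algebra_simps)

lemma group_Q8: "group Q8"
proof (rule groupI)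
  show "x \<otimes>\<^bsub>Q8\<^esub> y \<in> carrier Q8" if "x \<in> carrier Q8" "y \<in> carrier Q8" for x y
    using that by (auto simp: Q8_def)
  show "\<exists>y\<in>carrier Q8. y \<otimes>\<^bsub>Q8\<^esub> x = \<one>\<^bsub>Q8\<^esub>" if "x \<in> carrier Q8" for x
    using that by (auto simp: Q8_def)
qed (auto simp: Q8_def quat_mult_assoc)

lemma card_Q8: "card (carrier Q8) = 8"
  by (simp add: Q8_def)

lemma Q8_relations:
  "quat_mult (0,1,0,0) (0,1,0,0) = (-1,0,0,0)"
  "quat_mult (0,0,1,0) (0,0,1,0) = (-1,0,0,0)"
  "quat_mult (0,0,0,1) (0,0,0,1) = (-1,0,0,0)"
  "quat_mult (quat_mult (0,1,0,0) (0,0,1,0)) (0,0,0,1) = (-1,0,0,0)"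
  by simp_all

end

theory Submission
  imports Defs
begin

text \<open>
  Conjugation by \<open>a\<close> and \<open>b\<close> induces commuting automorphisms \<open>f\<close>, \<open>g\<close> of \<open>Q8\<close>, and \<open>a \<gamma>1\<close>
  commutes with \<open>b \<gamma>2\<close> iff \<open>g \<gamma>1 * \<gamma>2 = f \<gamma>2 * \<gamma>1\<close>. An automorphism is determined by the images of
  \<open>i\<close> and \<open>j\<close>, which leaves 24 candidates, and the solutions are counted for each of the
  commuting pairs.
\<close>

section \<open>Automorphisms of \<open>Q8\<close> in computable form\<close>

definition Q8_list :: "int_quat list" where
  "Q8_list = [(1, 0, 0, 0), (-1, 0, 0, 0), (0, 1, 0, 0), (0, -1, 0, 0),
              (0, 0, 1, 0), (0, 0, -1, 0), (0, 0, 0, 1), (0, 0, 0, -1)]"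

lemma set_Q8_list: "set Q8_list = carrier Q8"
  by (simp add: Q8_list_def Q8_def)

lemma distinct_Q8_list: "distinct Q8_list"
  by (simp add: Q8_list_def)

lemma mult_Q8: "x \<otimes>\<^bsub>Q8\<^esub> y = quat_mult x y"
  by (simp add: Q8_def)

text \<open>In coordinates, the integer-linear map that fixes 1 and sends i, j, k to the first three
  arguments.\<close>

fun quat_lin :: "int_quat \<Rightarrow> int_quat \<Rightarrow> int_quat \<Rightarrow> int_quat \<Rightarrow> int_quat" where
  "quat_lin (u0, u1, u2, u3) (v0, v1, v2, v3) (t0, t1, t2, t3) (w, x, y, z) =
     (w + x * u0 + y * v0 + z * t0, x * u1 + y * v1 + z * t1,
      x * u2 + y * v2 + z * t2, x * u3 + y * v3 + z * t3)"

text \<open>The pair lists the intended images of i and j; the image of k = ij is then forced.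
  Linear extension also settles the negatives.\<close>

definition Q8_endo :: "int_quat \<times> int_quat \<Rightarrow> int_quat \<Rightarrow> int_quat" where
  "Q8_endo = (\<lambda>(u, v). quat_lin u v (quat_mult u v))"

lemma quat_lin_basis:
  "quat_lin u v t (1, 0, 0, 0) = (1, 0, 0, 0)"
  "quat_lin u v t (0, 1, 0, 0) = u"
  "quat_lin u v t (0, 0, 1, 0) = v"
  "quat_lin u v t (0, 0, 0, 1) = t"
  by (cases u; cases v; cases t; simp)+

lemma quat_lin_minus:
  "quat_lin u v t (-w, -x, -y, -z) = quat_mult (-1, 0, 0, 0) (quat_lin u v t (w, x, y, z))"
  by (cases u; cases v; cases t) simp

lemma Q8_endo_basis:
  "Q8_endo (u, v) (1, 0, 0, 0) = (1, 0, 0, 0)"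
  "Q8_endo (u, v) (0, 1, 0, 0) = u"
  "Q8_endo (u, v) (0, 0, 1, 0) = v"
  "Q8_endo (u, v) (0, 0, 0, 1) = quat_mult u v"
  by (simp_all add: Q8_endo_def quat_lin_basis)

lemma Q8_endo_minus:
  "Q8_endo p (-w, -x, -y, -z) = quat_mult (-1, 0, 0, 0) (Q8_endo p (w, x, y, z))"
  by (simp add: Q8_endo_def case_prod_unfold quat_lin_minus)

text \<open>The relations rule out u or v equal to 1 or -1, and v equal to u or -u. This leaves 6 *
  4 = 24 pairs, as many as \<open>Q8\<close> has automorphisms.\<close>

definition Q8_frames :: "(int_quat \<times> int_quat) list" where
  "Q8_frames = filter (\<lambda>(u, v). quat_mult u u = (-1, 0, 0, 0) \<and> quat_mult v v = (-1, 0, 0, 0) \<and>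
     quat_mult (quat_mult u v) (quat_mult u v) = (-1, 0, 0, 0)) (List.product Q8_list Q8_list)"

text \<open>An automorphism fixes 1 and -1, so it preserves the relations saying that i, j and ij
  square to -1, and its values at i and j fix all others.\<close>

lemma Q8_automorphism_eq_endo:
  assumes closed: "\<And>x. x \<in> carrier Q8 \<Longrightarrow> f x \<in> carrier Q8"
    and mult: "\<And>x y. x \<in> carrier Q8 \<Longrightarrow> y \<in> carrier Q8 \<Longrightarrow> f (quat_mult x y) = quat_mult (f x) (f y)"
    and inj: "inj_on f (carrier Q8)"
  defines "p \<equiv> (f (0, 1, 0, 0), f (0, 0, 1, 0))"
  shows "p \<in> set Q8_frames" and "\<And>x. x \<in> carrier Q8 \<Longrightarrow> f x = Q8_endo p x"
proof -
  let ?e = "(1, 0, 0, 0) :: int_quat" and ?n = "(-1, 0, 0, 0) :: int_quat"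
    and ?i = "(0, 1, 0, 0) :: int_quat" and ?j = "(0, 0, 1, 0) :: int_quat"
    and ?k = "(0, 0, 0, 1) :: int_quat"
  have mem: "?e \<in> carrier Q8" "?n \<in> carrier Q8" "?i \<in> carrier Q8" "?j \<in> carrier Q8" "?k \<in> carrier Q8"
    by (simp_all add: Q8_def)
  \<comment> \<open>An idempotent of a group is its identity.\<close>
  have "quat_mult (f ?e) (f ?e) = f ?e"
    using mult[of ?e ?e] mem by simp
  with closed[OF mem(1)] have e: "f ?e = ?e"
    by (auto simp: Q8_def)
  \<comment> \<open>Only 1 and -1 have square 1 in \<open>Q8\<close>, and injectivity excludes
    1.\<close>
  have "quat_mult (f ?n) (f ?n) = ?e"
    using mult[of ?n ?n] mem e by simp
  moreover have "f ?n \<noteq> ?e"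
    using inj_onD[OF inj, of ?n ?e] mem e by auto
  ultimately have n: "f ?n = ?n"
    using closed[OF mem(2)] by (auto simp: Q8_def)
  have k: "f ?k = quat_mult (f ?i) (f ?j)"
    using mult[of ?i ?j] mem by simp
  have squares: "quat_mult (f ?i) (f ?i) = ?n" "quat_mult (f ?j) (f ?j) = ?n"
    "quat_mult (f ?k) (f ?k) = ?n"
    using mult[of ?i ?i] mult[of ?j ?j] mult[of ?k ?k] mem n by simp_all
  show "p \<in> set Q8_frames"
    using squares k closed mem by (simp add: Q8_frames_def p_def set_Q8_list)
  \<comment> \<open>Negation is multiplication by -1, which both maps respect, so agreement at 1, i,
    j, k spreads to their negatives.\<close>
  have minus: "f (-w, -x, -y, -z) = Q8_endo p (-w, -x, -y, -z)"
    if "(w, x, y, z) \<in> carrier Q8" "f (w, x, y, z) = Q8_endo p (w, x, y, z)" for w x y z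
  proof -
    have "f (-w, -x, -y, -z) = quat_mult (f ?n) (f (w, x, y, z))"
      using mult[OF mem(2) that(1)] by simp
    then show ?thesis
      by (simp only: n that(2) Q8_endo_minus)
  qed
  have basis: "f ?e = Q8_endo p ?e" "f ?i = Q8_endo p ?i" "f ?j = Q8_endo p ?j" "f ?k = Q8_endo p ?k"
    using e k by (simp_all add: p_def Q8_endo_basis)
  have minus_basis: "f (-1, 0, 0, 0) = Q8_endo p (-1, 0, 0, 0)"
    "f (0, -1, 0, 0) = Q8_endo p (0, -1, 0, 0)" "f (0, 0, -1, 0) = Q8_endo p (0, 0, -1, 0)"
    "f (0, 0, 0, -1) = Q8_endo p (0, 0, 0, -1)"
    using minus[OF mem(1) basis(1)] minus[OF mem(3) basis(2)] minus[OF mem(4) basis(3)]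
      minus[OF mem(5) basis(4)] by simp_all
  show "f x = Q8_endo p x" if "x \<in> carrier Q8" for x
  proof -
    have "x \<in> {?e, ?n, ?i, (0, -1, 0, 0), ?j, (0, 0, -1, 0), ?k, (0, 0, 0, -1)}"
      using that by (simp add: Q8_def)
    then show ?thesis
      by (elim insertE emptyE) (simp_all only: basis minus_basis)
  qed
qed

text \<open>The components of \<open>q\<close> are the images of i and j under
  \<open>Q8_endo q\<close>, so the two composites are compared at the generators i and j.\<close>

definition endos_commute :: "int_quat \<times> int_quat \<Rightarrow> int_quat \<times> int_quat \<Rightarrow> bool" where
  "endos_commute p q \<longleftrightarrow> Q8_endo p (fst q) = Q8_endo q (fst p) \<and> Q8_endo p (snd q) = Q8_endo q (snd p)"

section \<open>Counting solutions in \<open>Q8\<close>\<close>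

text \<open>Pairing each element with its image lets the evaluation compute every image only once.\<close>

definition count_solutions :: "int_quat \<times> int_quat \<Rightarrow> int_quat \<times> int_quat \<Rightarrow> nat" where
  "count_solutions p q =
     length (filter (\<lambda>((x, x'), (y, y')). quat_mult x' y = quat_mult y' x)
       (List.product (map (\<lambda>x. (x, Q8_endo q x)) Q8_list) (map (\<lambda>y. (y, Q8_endo p y)) Q8_list)))"

lemma product_map_map:
  "List.product (map f xs) (map g ys) = map (map_prod f g) (List.product xs ys)"
  by (induction xs) simp_all

text \<open>The product list has no repetitions, so the length of its filtered part is a
  cardinality.\<close>

lemma count_solutions_eq_card:
  "count_solutions p q =
     card {(x, y) \<in> carrier Q8 \<times> carrier Q8. quat_mult (Q8_endo q x) y = quat_mult (Q8_endo p y) x}"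
proof -
  let ?P = "\<lambda>(x, y). quat_mult (Q8_endo q x) y = quat_mult (Q8_endo p y) x"
  have "count_solutions p q = length (filter ?P (List.product Q8_list Q8_list))"
    by (simp add: count_solutions_def product_map_map filter_map o_def map_prod_def case_prod_unfold)
  also have "\<dots> = card (set (filter ?P (List.product Q8_list Q8_list)))"
    by (rule distinct_card[symmetric]) (simp add: distinct_product distinct_Q8_list)
  also have "set (filter ?P (List.product Q8_list Q8_list)) = {z \<in> carrier Q8 \<times> carrier Q8. ?P z}"
    by (auto simp: set_Q8_list)
  finally show ?thesis
    by (simp add: case_prod_unfold Collect_conj_eq mem_Times_iff)
qed

text \<open>The conditional, unlike an implication, keeps non-commuting pairs from being counted.\<close>

lemma count_solutions_all_frames:
  "list_all (\<lambda>p. list_all (\<lambda>q. if endos_commute p q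
      then count_solutions p q \<in> set [8, 16, 24, 40] else True) Q8_frames) Q8_frames"
  by code_simp

text \<open>Carries the finite evaluation over to arbitrary commuting automorphisms. As an
  illustration, if \<open>f\<close> is the identity, the equation says that y conjugates x to
  \<open>g x\<close>, and the count is 8 times the number of conjugacy classes that \<open>g\<close>
  preserves: 5, 3 or 2.\<close>

lemma card_solutions_Q8:
  assumes f: "\<And>x. x \<in> carrier Q8 \<Longrightarrow> f x \<in> carrier Q8"
      "\<And>x y. x \<in> carrier Q8 \<Longrightarrow> y \<in> carrier Q8 \<Longrightarrow> f (quat_mult x y) = quat_mult (f x) (f y)"
      "inj_on f (carrier Q8)"
    and g: "\<And>x. x \<in> carrier Q8 \<Longrightarrow> g x \<in> carrier Q8"
      "\<And>x y. x \<in> carrier Q8 \<Longrightarrow> y \<in> carrier Q8 \<Longrightarrow> g (quat_mult x y) = quat_mult (g x) (g y)"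
      "inj_on g (carrier Q8)"
    and comm: "\<And>x. x \<in> carrier Q8 \<Longrightarrow> f (g x) = g (f x)"
  shows "card {(x, y) \<in> carrier Q8 \<times> carrier Q8. quat_mult (g x) y = quat_mult (f y) x}
    \<in> {8, 16, 24, 40}"
proof -
  define p where "p = (f (0, 1, 0, 0), f (0, 0, 1, 0))"
  define q where "q = (g (0, 1, 0, 0), g (0, 0, 1, 0))"
  have p: "p \<in> set Q8_frames" "\<And>x. x \<in> carrier Q8 \<Longrightarrow> f x = Q8_endo p x"
    using Q8_automorphism_eq_endo[of f, folded p_def] f by blast+
  have q: "q \<in> set Q8_frames" "\<And>x. x \<in> carrier Q8 \<Longrightarrow> g x = Q8_endo q x"
    using Q8_automorphism_eq_endo[of g, folded q_def] g by blast+
  have ij: "(0, 1, 0, 0) \<in> carrier Q8" "(0, 0, 1, 0) \<in> carrier Q8"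
    by (simp_all add: Q8_def)
  \<comment> \<open>At z = i and z = j these are the two equations of
    \<open>endos_commute\<close>.\<close>
  have "Q8_endo p (g z) = Q8_endo q (f z)" if "z \<in> carrier Q8" for z
    using comm[OF that] p(2)[OF g(1)[OF that]] q(2)[OF f(1)[OF that]] by simp
  from this[OF ij(1)] this[OF ij(2)] have "endos_commute p q"
    by (simp add: endos_commute_def p_def q_def)
  then have "count_solutions p q \<in> {8, 16, 24, 40}"
    using count_solutions_all_frames p(1) q(1) by (auto simp: list_all_iff split: if_splits)
  moreover have "{(x, y) \<in> carrier Q8 \<times> carrier Q8. quat_mult (g x) y = quat_mult (f y) x} =
    {(x, y) \<in> carrier Q8 \<times> carrier Q8. quat_mult (Q8_endo q x) y = quat_mult (Q8_endo p y) x}"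
    using p(2) q(2) by auto
  ultimately show ?thesis
    by (simp add: count_solutions_eq_card)
qed

section \<open>Conjugation in an arbitrary group\<close>

context group
begin

text \<open>Serves as a rewrite rule after \<open>m_assoc\<close>, when c and its inverse are
  neighbours in a right-nested product.\<close>

lemma inv_cancel_left:
  assumes "c \<in> carrier G" "x \<in> carrier G"
  shows "c \<otimes> (inv c \<otimes> x) = x"
  using assms by (simp flip: m_assoc)

lemma inv_conj_mult:
  assumes "c \<in> carrier G" "x \<in> carrier G" "y \<in> carrier G"
  shows "inv c \<otimes> (x \<otimes> y) \<otimes> c = (inv c \<otimes> x \<otimes> c) \<otimes> (inv c \<otimes> y \<otimes> c)"
  using assms by (simp add: m_assoc inv_cancel_left)

text \<open>Both sides are conjugation by the product ab = ba.\<close>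

lemma inv_conj_commute:
  assumes "a \<in> carrier G" "b \<in> carrier G" "x \<in> carrier G" "a \<otimes> b = b \<otimes> a"
  shows "inv a \<otimes> (inv b \<otimes> x \<otimes> b) \<otimes> a = inv b \<otimes> (inv a \<otimes> x \<otimes> a) \<otimes> b"
proof -
  have "inv a \<otimes> (inv b \<otimes> x \<otimes> b) \<otimes> a = inv (b \<otimes> a) \<otimes> x \<otimes> (b \<otimes> a)"
    using assms(1-3) by (simp add: m_assoc inv_mult_group)
  also have "\<dots> = inv (a \<otimes> b) \<otimes> x \<otimes> (a \<otimes> b)"
    by (simp add: assms(4))
  also have "\<dots> = inv b \<otimes> (inv a \<otimes> x \<otimes> a) \<otimes> b"
    using assms(1-3) by (simp add: m_assoc inv_mult_group)
  finally show ?thesis .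
qed

text \<open>Moving b left past x, or a left past y, conjugates the element passed. Both products
  then begin with ab = ba, which cancels.\<close>

lemma translates_commute_iff:
  assumes "a \<in> carrier G" "b \<in> carrier G" "x \<in> carrier G" "y \<in> carrier G" "a \<otimes> b = b \<otimes> a"
  shows "(a \<otimes> x) \<otimes> (b \<otimes> y) = (b \<otimes> y) \<otimes> (a \<otimes> x) \<longleftrightarrow>
    (inv b \<otimes> x \<otimes> b) \<otimes> y = (inv a \<otimes> y \<otimes> a) \<otimes> x"
proof -
  have 1: "(a \<otimes> x) \<otimes> (b \<otimes> y) = (a \<otimes> b) \<otimes> ((inv b \<otimes> x \<otimes> b) \<otimes> y)"
    using assms(1-4) by (simp add: m_assoc inv_cancel_left)
  have "(b \<otimes> y) \<otimes> (a \<otimes> x) = (b \<otimes> a) \<otimes> ((inv a \<otimes> y \<otimes> a) \<otimes> x)"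
    using assms(1-4) by (simp add: m_assoc inv_cancel_left)
  then have 2: "(b \<otimes> y) \<otimes> (a \<otimes> x) = (a \<otimes> b) \<otimes> ((inv a \<otimes> y \<otimes> a) \<otimes> x)"
    using assms(5) by simp
  show ?thesis
    unfolding 1 2 using assms(1-4) by simp
qed

end

section \<open>Transport from the normal subgroup to \<open>Q8\<close>\<close>

theorem corollary2:
  fixes G' :: "('a, 'm) monoid_scheme" and Q :: "'a set" and a b :: 'a
  assumes "group G'"
    and "Q \<lhd> G'"
    and "G'\<lparr>carrier := Q\<rparr> \<cong> Q8"
    and "a \<in> carrier G'" and "b \<in> carrier G'"
    and "a \<otimes>\<^bsub>G'\<^esub> b = b \<otimes>\<^bsub>G'\<^esub> a"
  shows "card {(\<gamma>1, \<gamma>2) \<in> Q \<times> Q.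
            (a \<otimes>\<^bsub>G'\<^esub> \<gamma>1) \<otimes>\<^bsub>G'\<^esub> (b \<otimes>\<^bsub>G'\<^esub> \<gamma>2) =
            (b \<otimes>\<^bsub>G'\<^esub> \<gamma>2) \<otimes>\<^bsub>G'\<^esub> (a \<otimes>\<^bsub>G'\<^esub> \<gamma>1)} \<in> {8, 16, 24, 40}"
proof -
  interpret G: group G' by fact
  interpret N: normal Q G' by fact
  have Qsub: "x \<in> carrier G'" if "x \<in> Q" for x
    using that N.subset by blast
  define conj where "conj c x = inv\<^bsub>G'\<^esub> c \<otimes>\<^bsub>G'\<^esub> x \<otimes>\<^bsub>G'\<^esub> c" for c x
  have conj_mem: "conj c x \<in> Q" if "c \<in> carrier G'" "x \<in> Q" for c x
    using that by (simp add: conj_def N.inv_op_closed1)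
  have conj_mult: "conj c (x \<otimes>\<^bsub>G'\<^esub> y) = conj c x \<otimes>\<^bsub>G'\<^esub> conj c y"
    if "c \<in> carrier G'" "x \<in> Q" "y \<in> Q" for c x y
    using that Qsub by (simp add: conj_def G.inv_conj_mult)
  have conj_inj: "x = y" if "conj c x = conj c y" "c \<in> carrier G'" "x \<in> Q" "y \<in> Q" for c x y
    using that Qsub by (simp add: conj_def)
  obtain h where h: "h \<in> iso (G'\<lparr>carrier := Q\<rparr>) Q8"
    using assms(3) by (auto simp: is_iso_def)
  then have bij: "bij_betw h Q (carrier Q8)"
    and h_mult: "\<And>x y. x \<in> Q \<Longrightarrow> y \<in> Q \<Longrightarrow> h (x \<otimes>\<^bsub>G'\<^esub> y) = quat_mult (h x) (h y)"
    by (auto simp: iso_def hom_def mult_Q8)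
  define k where "k = inv_into Q h"
  have kh: "k (h x) = x" if "x \<in> Q" for x
    using that bij by (simp add: k_def bij_betw_inv_into_left)
  have hk: "h (k z) = z" if "z \<in> carrier Q8" for z
    using that bij by (simp add: k_def bij_betw_inv_into_right)
  have k_mem: "k z \<in> Q" if "z \<in> carrier Q8" for z
    using that bij by (metis k_def bij_betw_imp_surj_on inv_into_into)
  have h_mem: "h x \<in> carrier Q8" if "x \<in> Q" for x
    using that bij by (rule bij_betwE[rule_format, rotated])
  have h_eq: "h x = h y \<longleftrightarrow> x = y" if "x \<in> Q" "y \<in> Q" for x y
    using that by (metis kh)
  have k_mult: "k (quat_mult z w) = k z \<otimes>\<^bsub>G'\<^esub> k w" if "z \<in> carrier Q8" "w \<in> carrier Q8" for z w
    using that by (metis h_mult hk kh k_mem N.m_closed)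
  \<comment> \<open>Conjugation by c, carried over to \<open>Q8\<close> along \<open>h\<close>;
    normality of \<open>Q\<close> keeps it inside.\<close>
  define F where "F c z = h (conj c (k z))" for c z
  have F_mem: "F c z \<in> carrier Q8" if "c \<in> carrier G'" "z \<in> carrier Q8" for c z
    using that by (simp add: F_def h_mem conj_mem k_mem)
  have F_mult: "F c (quat_mult z w) = quat_mult (F c z) (F c w)"
    if "c \<in> carrier G'" "z \<in> carrier Q8" "w \<in> carrier Q8" for c z w
    using that by (simp add: F_def k_mult conj_mult h_mult conj_mem k_mem)
  \<comment> \<open>Each of \<open>k\<close>, conjugation by c, and \<open>h\<close> is injective
    where it is applied.\<close>
  have F_inj: "inj_on (F c) (carrier Q8)" if "c \<in> carrier G'" for c
    by (rule inj_onI) (metis F_def conj_inj conj_mem h_eq hk k_mem that)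
  have F_comm: "F a (F b z) = F b (F a z)" if "z \<in> carrier Q8" for z
  proof -
    have "conj a (conj b (k z)) = conj b (conj a (k z))"
      using G.inv_conj_commute assms(4-6) Qsub[OF k_mem[OF that]] by (simp add: conj_def)
    then show ?thesis
      using assms(4,5) that by (simp add: F_def kh conj_mem k_mem)
  qed
  let ?S = "{(\<gamma>1, \<gamma>2) \<in> Q \<times> Q.
            (a \<otimes>\<^bsub>G'\<^esub> \<gamma>1) \<otimes>\<^bsub>G'\<^esub> (b \<otimes>\<^bsub>G'\<^esub> \<gamma>2) =
            (b \<otimes>\<^bsub>G'\<^esub> \<gamma>2) \<otimes>\<^bsub>G'\<^esub> (a \<otimes>\<^bsub>G'\<^esub> \<gamma>1)}"
  let ?T = "{(z, w) \<in> carrier Q8 \<times> carrier Q8. quat_mult (F b z) w = quat_mult (F a w) z}"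
  have iff: "(a \<otimes>\<^bsub>G'\<^esub> x) \<otimes>\<^bsub>G'\<^esub> (b \<otimes>\<^bsub>G'\<^esub> y) = (b \<otimes>\<^bsub>G'\<^esub> y) \<otimes>\<^bsub>G'\<^esub> (a \<otimes>\<^bsub>G'\<^esub> x) \<longleftrightarrow>
    quat_mult (F b (h x)) (h y) = quat_mult (F a (h y)) (h x)" if "x \<in> Q" "y \<in> Q" for x y
  proof -
    have "(a \<otimes>\<^bsub>G'\<^esub> x) \<otimes>\<^bsub>G'\<^esub> (b \<otimes>\<^bsub>G'\<^esub> y) = (b \<otimes>\<^bsub>G'\<^esub> y) \<otimes>\<^bsub>G'\<^esub> (a \<otimes>\<^bsub>G'\<^esub> x) \<longleftrightarrow>
      conj b x \<otimes>\<^bsub>G'\<^esub> y = conj a y \<otimes>\<^bsub>G'\<^esub> x"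
      unfolding conj_def using G.translates_commute_iff assms(4-6) that Qsub by blast
    also have "\<dots> \<longleftrightarrow> h (conj b x \<otimes>\<^bsub>G'\<^esub> y) = h (conj a y \<otimes>\<^bsub>G'\<^esub> x)"
      using that assms(4,5) by (simp add: h_eq conj_mem)
    also have "\<dots> \<longleftrightarrow> quat_mult (F b (h x)) (h y) = quat_mult (F a (h y)) (h x)"
      using that assms(4,5) by (simp add: F_def kh h_mult conj_mem)
    finally show ?thesis .
  qed
  \<comment> \<open>By \<open>iff\<close>, applying \<open>h\<close> to both components preserves
    and reflects solutions, and \<open>k\<close> undoes it.\<close>
  have "bij_betw (map_prod h h) ?S ?T"
    by (rule bij_betw_byWitness[where f' = "map_prod k k"])
       (auto simp: kh hk h_mem k_mem iff)
  then have "card ?S = card ?T"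
    by (rule bij_betw_same_card)
  then show ?thesis
    using card_solutions_Q8[of "F a" "F b"] F_mem F_mult F_inj F_comm assms(4,5) by simp
qed

end
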